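(* Let $G$ be a countable discrete amenable group, $(V,\|\cdot\|)$ a complete semi-normed (real) vector space, $\pi: G \to \mathrm{Isom}(V)$ a uniformly bounded representation, and $\varphi \in \mathcal{M}$ a set map. Given a non-empty subset $W \subseteq V$, the following are equivalent: (A1) The set map $\varphi$ is asymptotically additive relative to $W$. (A2) There exists an additive realization $v \in \overline{W+\mathcal{L}_W}$ of $\varphi$. In particular, if $\varphi$ is asymptotically additive relative to $W$, then $\mathcal{R}_\varphi \subseteq \overline{W+\mathcal{L}}$, and the following dichotomy holds (exactly one of the two alternatives occurs): (B1) There exists an additive realization $w \in W$ of $\varphi$. (B2) There exists an additive realization $v \in V \setminus (W+\overline{\mathcal{L}})$ of $\varphi$.
   Context: $\mathcal{F}(G)$ is the set of non-empty finite subsets of $G$. For $K\in\mathcal{F}(G)$ and $\delta>0$, a set $F\in\mathcal{F}(G)$ is $(K,\delta)$-invariant if $|KF\,\Delta\, F|\le \delta|F|$; $G$ is amenable if a $(K,\delta)$-invariant set exists for every $(K,\delta)\in\mathcal{F}(G)\times\mathbb{R}_{>0}$. For $\rho:\mathcal{F}(G)\to\mathbb{R}$ and $L\in\mathbb{R}$, $\lim_{F\to G}\rho(F)=L$ means: for every $\epsilon>0$ there is $(K,\delta)\in\mathcal{F}(G)\times\mathbb{R}_{>0}$ such that $|\rho(F)-L|<\epsilon$ for every $(K,\delta)$-invariant $F$. Also $\limsup_{F\to G}\rho(F):=\inf_{(K,\delta)}\sup\{\rho(F): F \text{ is } (K,\delta)\text{-invariant}\}$. $V$ is complete: every $\|\cdot\|$-Cauchy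 sequence has a $\|\cdot\|$-limit in $V$. $\mathrm{Isom}(V)$ denotes the group of bounded invertible linear operators on $V$ (not necessarily isometries); a representation is a group homomorphism $\pi:G\to\mathrm{Isom}(V)$; it is uniformly bounded if $C_\pi:=\sup_{g\in G}\|\pi(g)\|_{\mathrm{op}}<\infty$. For $F\in\mathcal{F}(G)$ and $v\in V$, $A_Fv=\frac1{|F|}\sum_{g\in F}\pi(g^{-1})v$. For $W\subseteq V$, $\mathcal{L}_W$ is the linear span of $\{w-\pi(g)w: w\in W, g\in G\}$, and $\mathcal{L}:=\mathcal{L}_V$. Bars denote closure with respect to the semi-norm $\|\cdot\|$. A set map is a function $\varphi:\mathcal{F}(G)\to V$. It is $G$-equivariant if $\pi(g)\varphi(F)=\varphi(Fg^{-1})$ for all $g\in G$, $F\in\mathcal{F}(G)$, and bounded if $\sup_{F\in\mathcal{F}(G)}\|\varphi(F)/|F|\|<\infty$. $\mathcal{M}$ is the space of bounded and $G$-equivariant set maps. $\varphi\in\mathcal{M}$ is asymptotically additive relative to $W$ if $\inf_{w\in W}\limsup_{F\to G}\left\|\frac{\varphi(F)}{|F|}-A_Fw\right\|=0$. An additive realization of $\varphi$ is any $v\in V$ with $\lim_{F\to G}\left\|\frac{\varphi(F)}{|F|}-A_Fv\right\|=0$; $\mathcal{R}_\varphi$ is the set of all additive realizations of $\varphi$. *)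

theory Defs
  imports
    Complex_Main
    "HOL-Algebra.Coset"
    "HOL-Library.Extended_Real"
    "HOL-Library.Set_Algebras"
begin

definition finsets :: "('g, 'b) monoid_scheme \<Rightarrow> 'g set set" where
  "finsets G = {F. finite F \<and> F \<noteq> {} \<and> F \<subseteq> carrier G}"

definition invariant_set ::
    "('g, 'b) monoid_scheme \<Rightarrow> 'g set \<Rightarrow> real \<Rightarrow> 'g set \<Rightarrow> bool" where
  "invariant_set G K \<delta> F \<longleftrightarrow>
     F \<in> finsets G \<and>
     real (card (sym_diff (K <#>\<^bsub>G\<^esub> F) F)) \<le> \<delta> * real (card F)"

definition amenable :: "('g, 'b) monoid_scheme \<Rightarrow> bool" where
  "amenable G \<longleftrightarrow> (\<forall>K \<in> finsets G. \<forall>\<delta>>0. \<exists>F. invariant_set G K \<delta> F)"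

definition tends_along ::
    "('g, 'b) monoid_scheme \<Rightarrow> ('g set \<Rightarrow> real) \<Rightarrow> real \<Rightarrow> bool" where
  "tends_along G \<rho> L \<longleftrightarrow>
     (\<forall>\<epsilon>>0. \<exists>K \<in> finsets G. \<exists>\<delta>>0. \<forall>F. invariant_set G K \<delta> F \<longrightarrow> \<bar>\<rho> F - L\<bar> < \<epsilon>)"

text \<open>Extended reals, so that the supremum and the infimum need no boundedness side condition.\<close>

definition limsup_along ::
    "('g, 'b) monoid_scheme \<Rightarrow> ('g set \<Rightarrow> real) \<Rightarrow> ereal" where
  "limsup_along G \<rho> =
     (INF (K, \<delta>) \<in> finsets G \<times> {0<..}. SUP F \<in> {F. invariant_set G K \<delta> F}. ereal (\<rho> F))"

definition seminorm :: "('v::real_vector \<Rightarrow> real) \<Rightarrow> bool" where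
  "seminorm p \<longleftrightarrow>
     (\<forall>x. 0 \<le> p x) \<and>
     (\<forall>c x. p (c *\<^sub>R x) = \<bar>c\<bar> * p x) \<and>
     (\<forall>x y. p (x + y) \<le> p x + p y)"

definition complete_seminorm :: "('v::real_vector \<Rightarrow> real) \<Rightarrow> bool" where
  "complete_seminorm p \<longleftrightarrow>
     (\<forall>x :: nat \<Rightarrow> 'v.
        (\<forall>\<epsilon>>0. \<exists>N. \<forall>m\<ge>N. \<forall>n\<ge>N. p (x m - x n) < \<epsilon>) \<longrightarrow>
        (\<exists>l. (\<lambda>n. p (x n - l)) \<longlonglongrightarrow> 0))"

definition seminorm_closure :: "('v::real_vector \<Rightarrow> real) \<Rightarrow> 'v set \<Rightarrow> 'v set" where
  "seminorm_closure p S = {v. \<forall>\<epsilon>>0. \<exists>s\<in>S. p (v - s) < \<epsilon>}"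

definition bounded_operator ::
    "('v::real_vector \<Rightarrow> real) \<Rightarrow> ('v \<Rightarrow> 'v) \<Rightarrow> bool" where
  "bounded_operator p T \<longleftrightarrow> linear T \<and> (\<exists>C. \<forall>v. p (T v) \<le> C * p v)"

definition operator_norm ::
    "('v::real_vector \<Rightarrow> real) \<Rightarrow> ('v \<Rightarrow> 'v) \<Rightarrow> ereal" where
  "operator_norm p T = (SUP v \<in> {v. p v \<le> 1}. ereal (p (T v)))"

text \<open>
  The inverse is required to be bounded as well: for a semi-norm with non-trivial kernel this is
  not automatic, even on a complete space, and without it the operators do not form a group.
\<close>

definition isom_group ::
    "('v::real_vector \<Rightarrow> real) \<Rightarrow> ('v \<Rightarrow> 'v) monoid" where
  "isom_group p =
     \<lparr>carrier = {T. bounded_operator p T \<and>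
                    (\<exists>S. bounded_operator p S \<and> S \<circ> T = id \<and> T \<circ> S = id)},
      mult = (\<circ>), one = id\<rparr>"

lemma bounded_operator_id: "bounded_operator p id"
  unfolding bounded_operator_def by (auto simp: linear_id intro!: exI[of _ 1])

lemma bounded_operator_comp:
  assumes "seminorm p" "bounded_operator p S" "bounded_operator p T"
  shows "bounded_operator p (S \<circ> T)"
proof -
  obtain C D where C: "\<And>v. p (S v) \<le> C * p v" and D: "\<And>v. p (T v) \<le> D * p v"
    using assms(2,3) unfolding bounded_operator_def by blast
  have nonneg: "0 \<le> p v" for v
    using assms(1) unfolding seminorm_def by blast
  have "p (S (T v)) \<le> (\<bar>C\<bar> * D) * p v" for v
  proof -
    have "p (S (T v)) \<le> \<bar>C\<bar> * p (T v)"
      by (rule order_trans[OF C mult_right_mono[OF abs_ge_self nonneg]])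
    also have "\<dots> \<le> \<bar>C\<bar> * (D * p v)"
      by (rule mult_left_mono[OF D]) simp
    finally show ?thesis by (simp add: mult.assoc)
  qed
  then show ?thesis
    using assms(2,3) unfolding bounded_operator_def
    by (auto intro!: linear_compose exI[of _ "\<bar>C\<bar> * D"])
qed

lemma group_isom_group:
  assumes "seminorm p"
  shows "group (isom_group p)"
proof (rule groupI)
  fix S T
  assume "S \<in> carrier (isom_group p)" "T \<in> carrier (isom_group p)"
  then obtain S' T' where bdd: "bounded_operator p S" "bounded_operator p T"
      "bounded_operator p S'" "bounded_operator p T'"
    and inv: "S' \<circ> S = id" "S \<circ> S' = id" "T' \<circ> T = id" "T \<circ> T' = id"
    unfolding isom_group_def by auto
  have "(T' \<circ> S') \<circ> (S \<circ> T) = id" "(S \<circ> T) \<circ> (T' \<circ> S') = id"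
    using inv by (simp_all add: fun_eq_iff)
  then show "S \<otimes>\<^bsub>isom_group p\<^esub> T \<in> carrier (isom_group p)"
    using bounded_operator_comp[OF assms] bdd unfolding isom_group_def by auto
next
  fix T
  assume "T \<in> carrier (isom_group p)"
  then show "\<exists>S \<in> carrier (isom_group p). S \<otimes>\<^bsub>isom_group p\<^esub> T = \<one>\<^bsub>isom_group p\<^esub>"
    unfolding isom_group_def by auto
qed (auto simp: isom_group_def bounded_operator_id comp_assoc)

definition representation ::
    "('g, 'b) monoid_scheme \<Rightarrow> ('v::real_vector \<Rightarrow> real) \<Rightarrow> ('g \<Rightarrow> 'v \<Rightarrow> 'v) \<Rightarrow> bool" where
  "representation G p \<pi> \<longleftrightarrow> \<pi> \<in> hom G (isom_group p)"

definition uniformly_bounded ::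
    "('g, 'b) monoid_scheme \<Rightarrow> ('v::real_vector \<Rightarrow> real) \<Rightarrow> ('g \<Rightarrow> 'v \<Rightarrow> 'v) \<Rightarrow> bool" where
  "uniformly_bounded G p \<pi> \<longleftrightarrow> (SUP g \<in> carrier G. operator_norm p (\<pi> g)) < \<infinity>"

definition average ::
    "('g, 'b) monoid_scheme \<Rightarrow> ('g \<Rightarrow> 'v \<Rightarrow> 'v) \<Rightarrow> 'g set \<Rightarrow> 'v \<Rightarrow> 'v::real_vector" where
  "average G \<pi> F v = (1 / real (card F)) *\<^sub>R (\<Sum>g\<in>F. \<pi> (inv\<^bsub>G\<^esub> g) v)"

definition coboundaries ::
    "('g, 'b) monoid_scheme \<Rightarrow> ('g \<Rightarrow> 'v \<Rightarrow> 'v) \<Rightarrow> 'v set \<Rightarrow> 'v::real_vector set" where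
  "coboundaries G \<pi> W = span {w - \<pi> g w | w g. w \<in> W \<and> g \<in> carrier G}"

text \<open>Set maps are total on \<^typ>\<open>'g set\<close>; only their values on \<^term>\<open>finsets G\<close> matter.\<close>

definition equivariant ::
    "('g, 'b) monoid_scheme \<Rightarrow> ('g \<Rightarrow> 'v \<Rightarrow> 'v) \<Rightarrow> ('g set \<Rightarrow> 'v) \<Rightarrow> bool" where
  "equivariant G \<pi> \<phi> \<longleftrightarrow>
     (\<forall>g \<in> carrier G. \<forall>F \<in> finsets G. \<pi> g (\<phi> F) = \<phi> (F #>\<^bsub>G\<^esub> inv\<^bsub>G\<^esub> g))"

definition bounded_set_map ::
    "('g, 'b) monoid_scheme \<Rightarrow> ('v::real_vector \<Rightarrow> real) \<Rightarrow> ('g set \<Rightarrow> 'v) \<Rightarrow> bool" where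
  "bounded_set_map G p \<phi> \<longleftrightarrow>
     (SUP F \<in> finsets G. ereal (p (\<phi> F /\<^sub>R real (card F)))) < \<infinity>"

definition set_maps ::
    "('g, 'b) monoid_scheme \<Rightarrow> ('v::real_vector \<Rightarrow> real) \<Rightarrow> ('g \<Rightarrow> 'v \<Rightarrow> 'v) \<Rightarrow>
     ('g set \<Rightarrow> 'v) set" where
  "set_maps G p \<pi> = {\<phi>. bounded_set_map G p \<phi> \<and> equivariant G \<pi> \<phi>}"

definition asymptotically_additive ::
    "('g, 'b) monoid_scheme \<Rightarrow> ('v::real_vector \<Rightarrow> real) \<Rightarrow> ('g \<Rightarrow> 'v \<Rightarrow> 'v) \<Rightarrow>
     ('g set \<Rightarrow> 'v) \<Rightarrow> 'v set \<Rightarrow> bool" where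
  "asymptotically_additive G p \<pi> \<phi> W \<longleftrightarrow>
     (INF w\<in>W. limsup_along G (\<lambda>F. p (\<phi> F /\<^sub>R real (card F) - average G \<pi> F w))) = 0"

definition additive_realizations ::
    "('g, 'b) monoid_scheme \<Rightarrow> ('v::real_vector \<Rightarrow> real) \<Rightarrow> ('g \<Rightarrow> 'v \<Rightarrow> 'v) \<Rightarrow>
     ('g set \<Rightarrow> 'v) \<Rightarrow> 'v set" where
  "additive_realizations G p \<pi> \<phi> =
     {v. tends_along G (\<lambda>F. p (\<phi> F /\<^sub>R real (card F) - average G \<pi> F v)) 0}"

end

theory Submission
  imports Defs
begin

text \<open>
  Everything rests on a mean ergodic theorem for the averages \<open>A\<^sub>F\<close>: one has \<open>p (A\<^sub>F v) \<rightarrow> 0\<close> along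
  invariant sets exactly when \<open>v\<close> lies in the closure of the coboundaries
  (\<open>tendsto_average_iff\<close>). A generator \<open>v - \<pi> h v\<close> is averaged to zero because
  \<open>A\<^sub>F (\<pi> h v)\<close> is the average of \<open>v\<close> over \<open>h\<^sup>-\<^sup>1F\<close>, which nearly coincides with \<open>F\<close>. The uniform bound
  \<open>p (A\<^sub>F v) \<le> C * p v\<close> carries this over to limits. Conversely \<open>v - A\<^sub>F v\<close> always is a coboundary, so
  a small average of \<open>v\<close> puts \<open>v\<close> close to the coboundaries.

  Two additive realizations of \<open>\<phi>\<close> differ by a vector that is averaged to zero. Hence the set of
  additive realizations, when it is inhabited, is one coset of the closure of the coboundaries. The
  inclusion and the dichotomy are about where this coset lies: it meets \<open>W\<close> if and only if it is
  contained in \<open>W + closure \<L>\<close>.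

  The analytic content is therefore the existence of a realization (\<open>realization_exists\<close>).
  Approximate realizations \<open>w\<^sub>n \<in> W\<close> need not form a Cauchy sequence; only the averages of their
  differences are small. Replacing each step \<open>w\<^sub>n\<^sub>+\<^sub>1 - w\<^sub>n\<close> by its average over a suitable set \<open>F\<^sub>n\<close>
  makes the steps summable and changes the partial sums only by elements of the span \<open>\<L>\<^sub>W\<close>, which
  the averages cannot see in the limit. Completeness then yields the realization.
\<close>

section \<open>The filter of invariant sets\<close>

text \<open>
  Limits and upper limits over increasingly invariant sets are those of a filter, so that the
  calculus of filters applies to them.
\<close>

definition folner :: "('g, 'b) monoid_scheme \<Rightarrow> 'g set filter" where
  "folner G =
     (INF (K, \<delta>) \<in> finsets G \<times> {0<..}. principal {F. invariant_set G K \<delta> F})"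

text \<open>
  Enlarging \<open>K\<close> may make \<open>F - KF\<close> smaller, so \<open>F - K'F\<close> has to be controlled by a single
  translate with \<open>k \<in> K'\<close>: \<open>kF\<close> has as many elements as \<open>F\<close>, and therefore \<open>F - kF\<close> as many as \<open>kF - F\<close>. This
  costs the factor 2.
\<close>

lemma (in group) invariant_set_subset:
  assumes inv: "invariant_set G K \<delta> F" and K': "K' \<in> finsets G" "K' \<subseteq> K" and K: "K \<in> finsets G"
  shows "invariant_set G K' (2 * \<delta>) F"
proof -
  have F: "finite F" "F \<subseteq> carrier G" "F \<in> finsets G"
    and le: "real (card (sym_diff (K <#> F) F)) \<le> \<delta> * real (card F)"
    using inv unfolding invariant_set_def finsets_def by auto
  have fin: "finite (K <#> F)" "finite (K' <#> F)"
    using K K' F unfolding finsets_def set_mult_def by auto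
  obtain k where k: "k \<in> K'" "k \<in> carrier G"
    using K' unfolding finsets_def by blast
  define E where "E = (\<lambda>x. k \<otimes> x) ` F"
  have E: "finite E" "card E = card F" "E \<subseteq> K' <#> F"
    using F k inj_on_subset[OF inj_on_cmult] unfolding E_def set_mult_def
    by (auto intro!: card_image)
  have sub: "K' <#> F \<subseteq> K <#> F"
    using K' unfolding set_mult_def by blast
  have "card (F - E) = card (E - F)"
  proof -
    have "card (F - E) + card (F \<inter> E) = card F"
      by (metis F(1) Diff_disjoint Int_commute add.commute card_Int_Diff)
    moreover have "card (E - F) + card (F \<inter> E) = card E"
      by (metis E(1) Int_commute add.commute card_Int_Diff)
    ultimately show ?thesis using E(2) by simp
  qed
  also have "\<dots> \<le> card ((K <#> F) - F)"
    by (rule card_mono) (use fin E sub in auto)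
  finally have "card (F - E) \<le> card ((K <#> F) - F)" .
  moreover have "card (F - (K' <#> F)) \<le> card (F - E)"
    by (rule card_mono) (use F E in auto)
  moreover have "card ((K' <#> F) - F) \<le> card ((K <#> F) - F)"
    by (rule card_mono) (use fin sub in auto)
  moreover have "card (sym_diff (K' <#> F) F) \<le> card ((K' <#> F) - F) + card (F - (K' <#> F))"
    by (rule card_Un_le)
  moreover have "card ((K <#> F) - F) \<le> card (sym_diff (K <#> F) F)"
    by (rule card_mono) (use fin F in auto)
  ultimately have "card (sym_diff (K' <#> F) F) \<le> 2 * card (sym_diff (K <#> F) F)"
    by linarith
  then show ?thesis
    using le F(3) unfolding invariant_set_def by simp
qed

lemma (in group) eventually_folner:
  "eventually P (folner G) \<longleftrightarrow>
     (\<exists>K \<in> finsets G. \<exists>\<delta>>0. \<forall>F. invariant_set G K \<delta> F \<longrightarrow> P F)"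
proof -
  have one: "{\<one>} \<in> finsets G"
    by (simp add: finsets_def)
  have directed: "\<exists>x \<in> finsets G \<times> {0<..}.
      (case x of (K, \<delta>) \<Rightarrow> principal {F. invariant_set G K \<delta> F})
        \<le> inf (case a of (K, \<delta>) \<Rightarrow> principal {F. invariant_set G K \<delta> F})
              (case b of (K, \<delta>) \<Rightarrow> principal {F. invariant_set G K \<delta> F})"
    if ab: "a \<in> finsets G \<times> {0<..}" "b \<in> finsets G \<times> {0<..}" for a b :: "'a set \<times> real"
  proof -
    obtain K \<delta> K' \<delta>' where [simp]: "a = (K, \<delta>)" "b = (K', \<delta>')" by fastforce
    define d where "d = min \<delta> \<delta>' / 2"
    have KK: "K \<union> K' \<in> finsets G" and "K \<in> finsets G" "K' \<in> finsets G" and d: "d > 0"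
      using ab by (auto simp: finsets_def d_def)
    have weaken: "invariant_set G J e F"
      if "invariant_set G (K \<union> K') d F" "J \<in> {K, K'}" "2 * d \<le> e" for J e F
    proof -
      have "invariant_set G J (2 * d) F"
        using invariant_set_subset[OF that(1) _ _ KK] that(2) ab by auto
      moreover have "2 * d * real (card F) \<le> e * real (card F)"
        using that(3) by (intro mult_right_mono) auto
      ultimately show ?thesis
        unfolding invariant_set_def by simp
    qed
    have "{F. invariant_set G (K \<union> K') d F}
        \<subseteq> {F. invariant_set G K \<delta> F} \<inter> {F. invariant_set G K' \<delta>' F}"
      using weaken by (auto simp: d_def)
    then show ?thesis
      using KK d by (intro bexI[of _ "(K \<union> K', d)"]) auto
  qed
  have "eventually P (folner G) \<longleftrightarrow> (\<exists>x \<in> finsets G \<times> {0<..}.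
      eventually P (case x of (K, \<delta>) \<Rightarrow> principal {F. invariant_set G K \<delta> F}))"
    unfolding folner_def
    by (rule eventually_INF_base) (use one directed in \<open>auto intro: zero_less_one\<close>)
  then show ?thesis
    by (auto simp: eventually_principal)
qed

lemma (in group) tends_along_iff: "tends_along G \<rho> L \<longleftrightarrow> (\<rho> \<longlongrightarrow> L) (folner G)"
  by (simp add: tends_along_def tendsto_iff eventually_folner dist_real_def)

lemma (in group) limsup_along_lessD:
  assumes "limsup_along G \<rho> < ereal e"
  shows "\<forall>\<^sub>F F in folner G. \<rho> F < e"
proof -
  obtain K \<delta> where K: "K \<in> finsets G" "\<delta> > 0"
    and "(SUP F \<in> {F. invariant_set G K \<delta> F}. ereal (\<rho> F)) < ereal e"
    using assms unfolding limsup_along_def by (auto simp: INF_less_iff)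
  then have "invariant_set G K \<delta> F \<Longrightarrow> ereal (\<rho> F) < ereal e" for F
    by (meson SUP_upper le_less_trans mem_Collect_eq)
  with K show ?thesis
    unfolding eventually_folner by auto
qed

lemma (in group) limsup_along_leI:
  assumes "\<forall>\<^sub>F F in folner G. \<rho> F \<le> e"
  shows "limsup_along G \<rho> \<le> ereal e"
proof -
  obtain K \<delta> where "K \<in> finsets G" "\<delta> > 0" "\<And>F. invariant_set G K \<delta> F \<Longrightarrow> \<rho> F \<le> e"
    using assms unfolding eventually_folner by auto
  then show ?thesis
    unfolding limsup_along_def by (intro INF_lower2[of "(K, \<delta>)"]) (auto intro!: SUP_least)
qed

lemma (in group) folner_nontrivial:
  assumes "amenable G"
  shows "folner G \<noteq> bot"
proof -
  have "\<not> eventually (\<lambda>_. False) (folner G)"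
    using assms by (auto simp: eventually_folner amenable_def)
  then show ?thesis
    using trivial_limit_def by blast
qed

lemma (in group) limsup_along_nonneg:
  assumes "amenable G" "\<And>F. 0 \<le> \<rho> F"
  shows "0 \<le> limsup_along G \<rho>"
proof -
  have "0 \<le> (SUP F \<in> {F. invariant_set G K \<delta> F}. ereal (\<rho> F))"
    if "K \<in> finsets G" "\<delta> > 0" for K \<delta>
  proof -
    obtain F where "invariant_set G K \<delta> F"
      using assms(1) \<open>K \<in> finsets G\<close> \<open>\<delta> > 0\<close> unfolding amenable_def by blast
    then show ?thesis
      using assms(2) by (intro SUP_upper2[of F]) auto
  qed
  then show ?thesis
    unfolding limsup_along_def by (auto intro!: INF_greatest)
qed

lemma (in group) eventually_folner_finsets: "\<forall>\<^sub>F F in folner G. F \<in> finsets G"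
proof -
  have "{\<one>} \<in> finsets G"
    by (simp add: finsets_def)
  then show ?thesis
    unfolding eventually_folner invariant_set_def by (auto intro!: exI[of _ 1])
qed

section \<open>Averages of a uniformly bounded representation\<close>

lemma seminorm_nonneg: "seminorm p \<Longrightarrow> 0 \<le> p x"
  and seminorm_scaleR: "seminorm p \<Longrightarrow> p (c *\<^sub>R x) = \<bar>c\<bar> * p x"
  and seminorm_triangle: "seminorm p \<Longrightarrow> p (x + y) \<le> p x + p y"
  by (auto simp: seminorm_def)

lemma seminorm_zero: "seminorm p \<Longrightarrow> p 0 = 0"
  using seminorm_scaleR[of p 0 0] by simp

lemma seminorm_minus: "seminorm p \<Longrightarrow> p (- x) = p x"
  using seminorm_scaleR[of p "-1" x] by simp

lemma seminorm_diff_le: "seminorm p \<Longrightarrow> p (x - y) \<le> p x + p y"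
  using seminorm_triangle[of p x "- y"] by (simp add: seminorm_minus)

lemma seminorm_commute: "seminorm p \<Longrightarrow> p (x - y) = p (y - x)"
  using seminorm_minus[of p "x - y"] by simp

lemma seminorm_sum_le: "seminorm p \<Longrightarrow> p (sum f A) \<le> (\<Sum>x\<in>A. p (f x))"
proof (induction A rule: infinite_finite_induct)
  case (insert x A)
  then show ?case
    using seminorm_triangle[of p "f x" "sum f A"] by simp
qed (auto simp: seminorm_zero)

text \<open>
  The operator norms bound \<open>p (\<pi> g v)\<close> only where \<open>p v \<le> 1\<close>. Scaling reaches every \<open>v\<close> with
  \<open>p v > 0\<close>; on the kernel of the semi-norm the boundedness of each single operator is what counts.
\<close>

lemma uniform_operator_bound:
  assumes p: "seminorm p" and "representation G p \<pi>" and "uniformly_bounded G p \<pi>"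
  obtains C where "0 \<le> C" "\<And>g v. g \<in> carrier G \<Longrightarrow> p (\<pi> g v) \<le> C * p v"
proof -
  obtain C where C: "(SUP g \<in> carrier G. operator_norm p (\<pi> g)) < ereal C"
    using assms(3) less_PInf_Ex_of_nat unfolding uniformly_bounded_def
    by (metis ereal_dense2 infinity_ereal_def)
  have unit: "p (\<pi> g v) \<le> C" if "g \<in> carrier G" "p v \<le> 1" for g v
  proof -
    have "ereal (p (\<pi> g v)) \<le> operator_norm p (\<pi> g)"
      unfolding operator_norm_def using that by (intro SUP_upper) auto
    also have "\<dots> \<le> (SUP g \<in> carrier G. operator_norm p (\<pi> g))"
      using that by (intro SUP_upper)
    also have "\<dots> \<le> ereal C"
      using C by simp
    finally show ?thesis by simp
  qed
  have "p (\<pi> g v) \<le> \<bar>C\<bar> * p v" if g: "g \<in> carrier G" for g v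
  proof -
    have bdd: "bounded_operator p (\<pi> g)"
      using assms(2) g unfolding representation_def isom_group_def hom_def by auto
    show ?thesis
    proof (cases "p v = 0")
      case True
      obtain D where "\<And>v. p (\<pi> g v) \<le> D * p v"
        using bdd unfolding bounded_operator_def by blast
      from this[of v] True show ?thesis by simp
    next
      case False
      then have pos: "p v > 0"
        using seminorm_nonneg[OF p, of v] by linarith
      have "\<pi> g (v /\<^sub>R p v) = \<pi> g v /\<^sub>R p v"
        using bdd unfolding bounded_operator_def by (simp add: linear_scale)
      moreover have "p (\<pi> g (v /\<^sub>R p v)) \<le> C"
        using pos by (intro unit[OF g]) (simp add: seminorm_scaleR[OF p])
      ultimately have "p (\<pi> g v) / p v \<le> C"
        using pos by (simp add: seminorm_scaleR[OF p] divide_inverse_commute)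
      then have "p (\<pi> g v) \<le> C * p v"
        using pos by (simp add: divide_le_eq)
      also have "\<dots> \<le> \<bar>C\<bar> * p v"
        using pos by (intro mult_right_mono) auto
      finally show ?thesis .
    qed
  qed
  then show thesis
    using that[of "\<bar>C\<bar>"] by simp
qed

text \<open>
  The bound is a parameter of the locale, so that the estimates below are explicit in it.
\<close>

locale bounded_amenable_representation = group G for G (structure) +
  fixes p :: "'v::real_vector \<Rightarrow> real" and \<pi> :: "'a \<Rightarrow> 'v \<Rightarrow> 'v" and C :: real
  assumes amenable: "amenable G"
    and p: "seminorm p"
    and C_nonneg: "0 \<le> C"
    and linear: "g \<in> carrier G \<Longrightarrow> linear (\<pi> g)"
    and \<pi>_mult: "\<lbrakk>g \<in> carrier G; h \<in> carrier G\<rbrakk> \<Longrightarrow> \<pi> (g \<otimes> h) v = \<pi> g (\<pi> h v)"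
    and bound: "g \<in> carrier G \<Longrightarrow> p (\<pi> g v) \<le> C * p v"
begin

abbreviation A :: "'a set \<Rightarrow> 'v \<Rightarrow> 'v" where
  "A \<equiv> average G \<pi>"

abbreviation \<L> :: "'v set \<Rightarrow> 'v set" where
  "\<L> \<equiv> coboundaries G \<pi>"

lemma linear_average: "F \<in> finsets G \<Longrightarrow> linear (A F)"
proof -
  assume F: "F \<in> finsets G"
  then have "linear (\<lambda>v. \<Sum>g\<in>F. \<pi> (inv g) v)"
    by (intro linear_compose_sum) (auto simp: finsets_def intro!: linear)
  then show ?thesis
    unfolding average_def by (rule linear_compose_scale_right)
qed

lemma average_bound:
  assumes F: "F \<in> finsets G"
  shows "p (A F v) \<le> C * p v"
proof -
  have pos: "real (card F) > 0"
    using F by (auto simp: finsets_def card_gt_0_iff)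
  have "p (\<Sum>g\<in>F. \<pi> (inv g) v) \<le> (\<Sum>g\<in>F. p (\<pi> (inv g) v))"
    by (rule seminorm_sum_le[OF p])
  also have "\<dots> \<le> (\<Sum>g\<in>F. C * p v)"
    using F by (intro sum_mono bound) (auto simp: finsets_def)
  finally show ?thesis
    using pos by (simp add: average_def seminorm_scaleR[OF p] field_simps)
qed

lemma average_translate:
  assumes F: "F \<in> finsets G" and h: "h \<in> carrier G"
  shows "(\<Sum>g\<in>F. \<pi> (inv g) (\<pi> h v)) = (\<Sum>x \<in> {inv h} <#> F. \<pi> (inv x) v)"
proof -
  have "inj_on (\<lambda>g. inv h \<otimes> g) F"
    using F h by (auto simp: finsets_def inj_on_def subset_iff)
  moreover have "{inv h} <#> F = (\<lambda>g. inv h \<otimes> g) ` F"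
    by (auto simp: set_mult_def)
  moreover have "\<pi> (inv (inv h \<otimes> g)) v = \<pi> (inv g) (\<pi> h v)" if "g \<in> F" for g
    using that F h by (auto simp: finsets_def inv_mult_group \<pi>_mult subset_iff)
  ultimately show ?thesis
    by (simp add: sum.reindex)
qed

text \<open>
  The sums over \<open>F\<close> and over \<open>h\<^sup>-\<^sup>1F\<close> differ only by terms from the symmetric difference, each of
  semi-norm at most \<open>C * p v\<close>.
\<close>

lemma average_coboundary_bound:
  assumes inv: "invariant_set G {inv h} \<delta> F" and h: "h \<in> carrier G"
  shows "p (A F (v - \<pi> h v)) \<le> \<delta> * (C * p v)"
proof -
  define E where "E = {inv h} <#> F"
  define f where "f g = \<pi> (inv g) v" for g
  have F: "F \<in> finsets G" "finite F" "F \<subseteq> carrier G"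
    and le: "real (card (sym_diff E F)) \<le> \<delta> * real (card F)"
    using inv unfolding invariant_set_def finsets_def E_def by auto
  have pos: "real (card F) > 0"
    using F by (auto simp: finsets_def card_gt_0_iff)
  have E: "finite E" "E \<subseteq> carrier G"
    using F h unfolding E_def set_mult_def by auto
  have part: "p (sum f X) \<le> real (card X) * (C * p v)" if "X \<subseteq> carrier G" for X
  proof -
    have "p (sum f X) \<le> (\<Sum>g\<in>X. p (f g))"
      by (rule seminorm_sum_le[OF p])
    also have "\<dots> \<le> (\<Sum>g\<in>X. C * p v)"
      using that unfolding f_def by (intro sum_mono bound) auto
    finally show ?thesis by simp
  qed
  have "(\<Sum>g\<in>F. \<pi> (inv g) (v - \<pi> h v)) = sum f F - sum f E"
  proof -
    have "(\<Sum>g\<in>F. \<pi> (inv g) (v - \<pi> h v)) = (\<Sum>g\<in>F. f g - \<pi> (inv g) (\<pi> h v))"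
      using F unfolding f_def by (intro sum.cong) (auto simp: linear_diff[OF linear])
    then show ?thesis
      using average_translate[OF F(1) h, of v] unfolding E_def f_def by (simp add: sum_subtractf)
  qed
  also have "\<dots> = sum f (F - E) - sum f (E - F)"
    using sum.Int_Diff[OF F(2), of f E] sum.Int_Diff[OF E(1), of f F] by (simp add: Int_commute)
  also have "p \<dots> \<le> real (card (F - E)) * (C * p v) + real (card (E - F)) * (C * p v)"
    by (rule order_trans[OF seminorm_diff_le[OF p] add_mono[OF part part]]) (use F E in auto)
  also have "\<dots> = real (card (sym_diff E F)) * (C * p v)"
    using F E by (subst card_Un_disjoint) (auto simp: algebra_simps)
  also have "\<dots> \<le> \<delta> * real (card F) * (C * p v)"
    using le C_nonneg seminorm_nonneg[OF p, of v] by (intro mult_right_mono) auto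
  finally show ?thesis
    using pos by (simp add: average_def seminorm_scaleR[OF p] field_simps)
qed

lemma tendsto_average_generator:
  assumes h: "h \<in> carrier G"
  shows "((\<lambda>F. p (A F (v - \<pi> h v))) \<longlongrightarrow> 0) (folner G)"
proof -
  have "\<exists>K \<in> finsets G. \<exists>\<delta>>0. \<forall>F. invariant_set G K \<delta> F \<longrightarrow> p (A F (v - \<pi> h v)) < \<epsilon>"
    if \<epsilon>: "\<epsilon> > 0" for \<epsilon>
  proof -
    define D where "D = C * p v"
    have D: "D \<ge> 0"
      using C_nonneg seminorm_nonneg[OF p, of v] by (simp add: D_def)
    define \<delta> where "\<delta> = \<epsilon> / (D + 1)"
    have "\<delta> > 0" "\<delta> * D < \<epsilon>"
      using \<epsilon> D by (simp_all add: \<delta>_def field_simps)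
    moreover have "{inv h} \<in> finsets G"
      using h by (simp add: finsets_def)
    ultimately show ?thesis
      using average_coboundary_bound[OF _ h, of _ _ v] unfolding D_def by (meson le_less_trans)
  qed
  then show ?thesis
    by (simp add: tendsto_iff eventually_folner seminorm_nonneg[OF p])
qed

section \<open>The mean ergodic theorem\<close>

lemma tendsto_average_add:
  assumes "((\<lambda>F. p (A F x)) \<longlongrightarrow> 0) (folner G)" "((\<lambda>F. p (A F y)) \<longlongrightarrow> 0) (folner G)"
  shows "((\<lambda>F. p (A F (x + y))) \<longlongrightarrow> 0) (folner G)"
proof (rule tendsto_sandwich[OF _ _ tendsto_const])
  show "\<forall>\<^sub>F F in folner G. p (A F (x + y)) \<le> p (A F x) + p (A F y)"
    using eventually_folner_finsets
    by eventually_elim (simp add: linear_add[OF linear_average] seminorm_triangle[OF p])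
  show "((\<lambda>F. p (A F x) + p (A F y)) \<longlongrightarrow> 0) (folner G)"
    using tendsto_add[OF assms] by simp
qed (simp add: seminorm_nonneg[OF p])

lemma tendsto_average_scaleR:
  assumes "((\<lambda>F. p (A F x)) \<longlongrightarrow> 0) (folner G)"
  shows "((\<lambda>F. p (A F (c *\<^sub>R x))) \<longlongrightarrow> 0) (folner G)"
proof (rule tendsto_cong[THEN iffD1])
  show "\<forall>\<^sub>F F in folner G. \<bar>c\<bar> * p (A F x) = p (A F (c *\<^sub>R x))"
    using eventually_folner_finsets
    by eventually_elim (simp add: linear_scale[OF linear_average] seminorm_scaleR[OF p])
  show "((\<lambda>F. \<bar>c\<bar> * p (A F x)) \<longlongrightarrow> 0) (folner G)"
    using tendsto_mult_left[OF assms, of "\<bar>c\<bar>"] by simp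
qed

lemma tendsto_average_coboundaries:
  assumes "l \<in> \<L> W"
  shows "((\<lambda>F. p (A F l)) \<longlongrightarrow> 0) (folner G)"
  using assms unfolding coboundaries_def
proof (induction rule: span_induct_alt)
  case base
  have "\<forall>\<^sub>F F in folner G. 0 = p (A F 0)"
    using eventually_folner_finsets
    by eventually_elim (simp add: linear_0[OF linear_average] seminorm_zero[OF p])
  then show ?case
    by (rule tendsto_cong[THEN iffD1]) simp
next
  case (step c x y)
  then show ?case
    using tendsto_average_generator by (auto intro!: tendsto_average_add tendsto_average_scaleR)
qed

text \<open>
  Only translates of \<open>w\<close> enter its average, so the difference lies already in the coboundaries
  generated by \<open>w\<close>. This is what keeps the construction below inside \<open>W + \<L>\<^sub>W\<close>.
\<close>

lemma diff_average_mem_coboundaries: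
  assumes F: "F \<in> finsets G" and w: "w \<in> W"
  shows "w - A F w \<in> \<L> W"
proof -
  have pos: "real (card F) > 0"
    using F by (auto simp: finsets_def card_gt_0_iff)
  have "w - A F w = (1 / real (card F)) *\<^sub>R (\<Sum>g\<in>F. w - \<pi> (inv g) w)"
    using pos by (simp add: average_def sum_subtractf scaleR_diff_right sum_constant_scaleR)
  moreover have "(\<Sum>g\<in>F. w - \<pi> (inv g) w) \<in> \<L> W"
    unfolding coboundaries_def using F w
    by (intro span_sum span_base) (auto simp: finsets_def)
  ultimately show ?thesis
    unfolding coboundaries_def by (simp add: span_scale)
qed

lemma coboundaries_mono: "W \<subseteq> W' \<Longrightarrow> \<L> W \<subseteq> \<L> W'"
  unfolding coboundaries_def by (rule span_mono) blast

text \<open>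
  Up to \<open>\<epsilon>\<close>, the averages of \<open>v\<close> are those of a nearby coboundary; in the other direction, one set
  \<open>F\<close> with a small average exhibits the coboundary \<open>v - A\<^sub>F v\<close> near \<open>v\<close>.
\<close>

theorem tendsto_average_iff:
  "((\<lambda>F. p (A F v)) \<longlongrightarrow> 0) (folner G) \<longleftrightarrow> v \<in> seminorm_closure p (\<L> UNIV)"
proof
  assume lim: "((\<lambda>F. p (A F v)) \<longlongrightarrow> 0) (folner G)"
  have "\<exists>s \<in> \<L> UNIV. p (v - s) < \<epsilon>" if "\<epsilon> > 0" for \<epsilon>
  proof -
    have "\<forall>\<^sub>F F in folner G. p (A F v) < \<epsilon>"
      using order_tendstoD(2)[OF lim that] .
    then obtain F where "p (A F v) < \<epsilon>" "F \<in> finsets G"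
      using eventually_happens'[OF folner_nontrivial[OF amenable]]
        eventually_conj[OF _ eventually_folner_finsets] by blast
    then show ?thesis
      using diff_average_mem_coboundaries[of F v UNIV] by (intro bexI[of _ "v - A F v"]) auto
  qed
  then show "v \<in> seminorm_closure p (\<L> UNIV)"
    unfolding seminorm_closure_def by blast
next
  assume v: "v \<in> seminorm_closure p (\<L> UNIV)"
  have "\<forall>\<^sub>F F in folner G. p (A F v) < \<epsilon>" if \<epsilon>: "\<epsilon> > 0" for \<epsilon>
  proof -
    define \<eta> where "\<eta> = \<epsilon> / (C + 1)"
    have "\<eta> > 0" "(C + 1) * \<eta> = \<epsilon>"
      using \<epsilon> C_nonneg by (simp_all add: \<eta>_def)
    then have \<eta>: "\<eta> > 0" "C * \<eta> + \<eta> = \<epsilon>"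
      by (simp_all add: distrib_right)
    obtain s where s: "s \<in> \<L> UNIV" "p (v - s) < \<eta>"
      using v \<eta> unfolding seminorm_closure_def by blast
    have "\<forall>\<^sub>F F in folner G. p (A F s) < \<eta>"
      using order_tendstoD(2)[OF tendsto_average_coboundaries[OF s(1)] \<eta>(1)] .
    with eventually_folner_finsets show ?thesis
    proof eventually_elim
      case (elim F)
      have "p (A F v) = p (A F (v - s) + A F s)"
        using elim(1) by (simp add: linear_diff[OF linear_average])
      also have "\<dots> \<le> C * p (v - s) + p (A F s)"
        by (rule order_trans[OF seminorm_triangle[OF p]]) (simp add: average_bound[OF elim(1)])
      also have "\<dots> \<le> C * \<eta> + p (A F s)"
        using s(2) C_nonneg by (simp add: mult_left_mono)
      finally show ?case
        using elim(2) \<eta>(2) by linarith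
    qed
  qed
  then show "((\<lambda>F. p (A F v)) \<longlongrightarrow> 0) (folner G)"
    by (simp add: tendsto_iff seminorm_nonneg[OF p])
qed

section \<open>Additive realizations\<close>

context
  fixes \<phi> :: "'a set \<Rightarrow> 'v"
begin

abbreviation err :: "'v \<Rightarrow> 'a set \<Rightarrow> real" where
  "err v F \<equiv> p (\<phi> F /\<^sub>R real (card F) - A F v)"

abbreviation \<R> :: "'v set" where
  "\<R> \<equiv> additive_realizations G p \<pi> \<phi>"

lemma mem_realizations_iff: "v \<in> \<R> \<longleftrightarrow> (err v \<longlongrightarrow> 0) (folner G)"
  by (simp add: additive_realizations_def tends_along_iff)

lemma err_perturb:
  assumes "F \<in> finsets G"
  shows "err u F \<le> err v F + p (A F (v - u))"
proof -
  have "\<phi> F /\<^sub>R real (card F) - A F u = (\<phi> F /\<^sub>R real (card F) - A F v) + A F (v - u)"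
    using assms by (simp add: linear_diff[OF linear_average])
  then show ?thesis
    by (metis seminorm_triangle[OF p])
qed

lemma average_diff_le_err:
  assumes "F \<in> finsets G"
  shows "p (A F (u - v)) \<le> err u F + err v F"
proof -
  have "A F (u - v) = (\<phi> F /\<^sub>R real (card F) - A F v) - (\<phi> F /\<^sub>R real (card F) - A F u)"
    using assms by (simp add: linear_diff[OF linear_average])
  then show ?thesis
    by (metis seminorm_diff_le[OF p] add.commute)
qed

text \<open>The realizations form one coset of the closure of the coboundaries.\<close>

lemma realization_diff:
  assumes "u \<in> \<R>" "v \<in> \<R>"
  shows "u - v \<in> seminorm_closure p (\<L> UNIV)"
  unfolding tendsto_average_iff[symmetric]
proof (rule tendsto_sandwich[OF _ _ tendsto_const])
  show "\<forall>\<^sub>F F in folner G. p (A F (u - v)) \<le> err u F + err v F"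
    using eventually_folner_finsets by eventually_elim (rule average_diff_le_err)
  show "((\<lambda>F. err u F + err v F) \<longlongrightarrow> 0) (folner G)"
    using assms tendsto_add[of "err u" 0 "folner G" "err v" 0]
    by (simp add: mem_realizations_iff)
qed (simp add: seminorm_nonneg[OF p])

lemma realization_shift:
  assumes "v \<in> \<R>" "v - u \<in> seminorm_closure p (\<L> UNIV)"
  shows "u \<in> \<R>"
  unfolding mem_realizations_iff
proof (rule tendsto_sandwich[OF _ _ tendsto_const])
  show "\<forall>\<^sub>F F in folner G. err u F \<le> err v F + p (A F (v - u))"
    using eventually_folner_finsets by eventually_elim (rule err_perturb)
  show "((\<lambda>F. err v F + p (A F (v - u))) \<longlongrightarrow> 0) (folner G)"
    using assms tendsto_add[of "err v" 0 "folner G" "\<lambda>F. p (A F (v - u))" 0]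
    by (simp add: mem_realizations_iff tendsto_average_iff)
qed (simp add: seminorm_nonneg[OF p])

lemma asymptotically_additive_iff:
  assumes "W \<noteq> {}"
  shows "asymptotically_additive G p \<pi> \<phi> W \<longleftrightarrow>
    (\<forall>\<epsilon>>0. \<exists>w \<in> W. \<forall>\<^sub>F F in folner G. err w F < \<epsilon>)"
proof
  assume add: "asymptotically_additive G p \<pi> \<phi> W"
  show "\<forall>\<epsilon>>0. \<exists>w \<in> W. \<forall>\<^sub>F F in folner G. err w F < \<epsilon>"
  proof (intro allI impI)
    fix \<epsilon> :: real assume "\<epsilon> > 0"
    then have "(INF w\<in>W. limsup_along G (err w)) < ereal \<epsilon>"
      using add unfolding asymptotically_additive_def by simp
    then obtain w where "w \<in> W" "limsup_along G (err w) < ereal \<epsilon>"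
      unfolding INF_less_iff by blast
    then show "\<exists>w \<in> W. \<forall>\<^sub>F F in folner G. err w F < \<epsilon>"
      using limsup_along_lessD by blast
  qed
next
  assume approx: "\<forall>\<epsilon>>0. \<exists>w \<in> W. \<forall>\<^sub>F F in folner G. err w F < \<epsilon>"
  have "(INF w\<in>W. limsup_along G (err w)) \<le> 0"
  proof (rule ereal_le_epsilon2)
    fix \<epsilon> :: real assume "\<epsilon> > 0"
    then obtain w where w: "w \<in> W" "\<forall>\<^sub>F F in folner G. err w F < \<epsilon>"
      using approx by blast
    have "limsup_along G (err w) \<le> ereal \<epsilon>"
      by (rule limsup_along_leI) (use w(2) in \<open>eventually_elim, simp\<close>)
    then show "(INF w\<in>W. limsup_along G (err w)) \<le> 0 + ereal \<epsilon>"
      using w(1) by (simp add: INF_lower2)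
  qed
  moreover have "0 \<le> (INF w\<in>W. limsup_along G (err w))"
    by (intro INF_greatest limsup_along_nonneg[OF amenable] seminorm_nonneg[OF p])
  ultimately show "asymptotically_additive G p \<pi> \<phi> W"
    unfolding asymptotically_additive_def by (rule antisym)
qed

text \<open>
  A nearby point \<open>w + l\<close> of \<open>W + \<L>\<^sub>W\<close> approximates the realization, and dropping \<open>l\<close> does not
  change the limit of the averages.
\<close>

lemma approximation_from_realization:
  assumes v: "v \<in> \<R>" "v \<in> seminorm_closure p (W + \<L> W)" and \<epsilon>: "\<epsilon> > 0"
  shows "\<exists>w \<in> W. \<forall>\<^sub>F F in folner G. err w F < \<epsilon>"
proof -
  define \<eta> where "\<eta> = \<epsilon> / (C + 2)"
  have "\<eta> > 0" "(C + 2) * \<eta> = \<epsilon>"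
    using \<epsilon> C_nonneg by (simp_all add: \<eta>_def)
  then have \<eta>: "\<eta> > 0" "C * \<eta> + 2 * \<eta> = \<epsilon>"
    by (simp_all add: distrib_right)
  obtain s where "s \<in> W + \<L> W" "p (v - s) < \<eta>"
    using v(2) \<eta> unfolding seminorm_closure_def by blast
  then obtain w l where wl: "w \<in> W" "l \<in> \<L> W" "p (v - (w + l)) < \<eta>"
    by (auto elim!: set_plus_elim)
  have "\<forall>\<^sub>F F in folner G. err v F < \<eta>"
    using order_tendstoD(2)[OF _ \<eta>(1)] v(1) unfolding mem_realizations_iff by blast
  moreover have "\<forall>\<^sub>F F in folner G. p (A F l) < \<eta>"
    using order_tendstoD(2)[OF tendsto_average_coboundaries[OF wl(2)] \<eta>(1)] .
  ultimately have "\<forall>\<^sub>F F in folner G. err w F < \<epsilon>"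
    using eventually_folner_finsets
  proof eventually_elim
    case (elim F)
    have "A F (v - w) = A F (v - (w + l)) + A F l"
      using elim(3) by (simp add: linear_diff[OF linear_average] linear_add[OF linear_average])
    then have "p (A F (v - w)) \<le> C * p (v - (w + l)) + p (A F l)"
      using seminorm_triangle[OF p, of "A F (v - (w + l))" "A F l"]
        average_bound[OF elim(3), of "v - (w + l)"] by simp
    also have "\<dots> \<le> C * \<eta> + p (A F l)"
      using wl(3) C_nonneg by (simp add: mult_left_mono)
    finally show ?case
      using err_perturb[OF elim(3), of w v] elim \<eta>(2) by linarith
  qed
  with wl(1) show ?thesis by blast
qed

text \<open>
  With \<open>w\<^sub>n\<close> of asymptotic error below \<open>2\<^sup>-\<^sup>n\<close>, the differences \<open>w\<^sub>n\<^sub>+\<^sub>1 - w\<^sub>n\<close> have averages below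
  \<open>2\<^sup>-\<^sup>n + 2\<^sup>-\<^sup>n\<^sup>-\<^sup>1\<close> over all sufficiently invariant sets. Summing such averages in place of the
  differences gives a Cauchy sequence that stays in \<open>w\<^sub>n + \<L>\<^sub>W\<close>.
\<close>

lemma realization_exists:
  assumes complete: "complete_seminorm p"
    and approx: "\<forall>\<epsilon>>0. \<exists>w \<in> W. \<forall>\<^sub>F F in folner G. err w F < \<epsilon>"
  shows "\<exists>v \<in> seminorm_closure p (W + \<L> W). v \<in> \<R>"
proof -
  have "\<forall>n. \<exists>x. x \<in> W \<and> (\<forall>\<^sub>F F in folner G. err x F < (1/2) ^ n)"
    using approx[unfolded Bex_def] by simp
  from choice[OF this] obtain w
    where "\<forall>n. w n \<in> W \<and> (\<forall>\<^sub>F F in folner G. err (w n) F < (1/2) ^ n)" ..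
  then have w: "w n \<in> W" "\<forall>\<^sub>F F in folner G. err (w n) F < (1/2) ^ n" for n
    by blast+
  have "\<exists>F \<in> finsets G. p (A F (w (Suc n) - w n)) < 2 * (1/2) ^ n" for n
  proof -
    have "\<forall>\<^sub>F F in folner G. F \<in> finsets G \<and> p (A F (w (Suc n) - w n)) < 2 * (1/2) ^ n"
      using w(2)[of n] w(2)[of "Suc n"] eventually_folner_finsets
    proof eventually_elim
      case (elim F)
      have "(1/2::real) ^ Suc n \<le> (1/2) ^ n"
        by simp
      then show ?case
        using elim average_diff_le_err[OF elim(3), of "w (Suc n)" "w n"] by linarith
    qed
    then show ?thesis
      using eventually_happens'[OF folner_nontrivial[OF amenable]] by blast
  qed
  then obtain S where S: "\<And>n. S n \<in> finsets G"
      "\<And>n. p (A (S n) (w (Suc n) - w n)) < 2 * (1/2) ^ n"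
    by metis
  define v where "v n = w 0 + (\<Sum>i<n. A (S i) (w (Suc i) - w i))" for n
  have coset: "v n - w n \<in> \<L> W" for n
  proof (induction n)
    case 0
    then show ?case
      by (simp add: v_def coboundaries_def span_zero)
  next
    case (Suc n)
    have "w m - A (S n) (w m) \<in> \<L> W" for m
      by (rule diff_average_mem_coboundaries[OF S(1) w(1)])
    then have "(v n - w n) - (w (Suc n) - A (S n) (w (Suc n))) + (w n - A (S n) (w n)) \<in> \<L> W"
      using Suc unfolding coboundaries_def by (blast intro: span_add span_diff)
    also have "(v n - w n) - (w (Suc n) - A (S n) (w (Suc n))) + (w n - A (S n) (w n))
        = v (Suc n) - w (Suc n)"
      by (simp add: v_def linear_diff[OF linear_average[OF S(1)]])
    finally show ?case .
  qed
  have tail: "p (v (n + k) - v n) \<le> 4 * (1/2) ^ n - 4 * (1/2) ^ (n + k)" for n k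
  proof (induction k)
    case 0
    then show ?case by (simp add: seminorm_zero[OF p])
  next
    case (Suc k)
    have "v (n + Suc k) - v n = (v (n + k) - v n) + A (S (n + k)) (w (Suc (n + k)) - w (n + k))"
      by (simp add: v_def)
    then have "p (v (n + Suc k) - v n)
        \<le> p (v (n + k) - v n) + p (A (S (n + k)) (w (Suc (n + k)) - w (n + k)))"
      by (metis seminorm_triangle[OF p])
    also have "\<dots> \<le> (4 * (1/2) ^ n - 4 * (1/2) ^ (n + k)) + 2 * (1/2) ^ (n + k)"
      using Suc S(2)[of "n + k"] by linarith
    finally show ?case by simp
  qed
  have close: "p (v m - v n) \<le> 4 * (1/2) ^ n" if "n \<le> m" for m n
  proof -
    have "0 \<le> 4 * (1/2::real) ^ m" by simp
    moreover have "p (v m - v n) \<le> 4 * (1/2) ^ n - 4 * (1/2) ^ m"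
      using tail[of n "m - n"] that by simp
    ultimately show ?thesis by linarith
  qed
  have small: "\<exists>N. \<forall>n\<ge>N. c * (1/2) ^ n < \<epsilon>" if "\<epsilon> > 0" for \<epsilon> c :: real
  proof -
    have "(\<lambda>n. c * (1/2::real) ^ n) \<longlonglongrightarrow> c * 0"
      by (intro tendsto_mult_left LIMSEQ_realpow_zero) auto
    then show ?thesis
      using order_tendstoD(2)[of "\<lambda>n. c * (1/2::real) ^ n" 0 sequentially \<epsilon>] that
      by (simp add: eventually_sequentially)
  qed
  have "\<exists>N. \<forall>m\<ge>N. \<forall>n\<ge>N. p (v m - v n) < \<epsilon>" if \<epsilon>: "\<epsilon> > 0" for \<epsilon>
  proof -
    obtain N where N: "\<forall>n\<ge>N. 4 * (1/2) ^ n < \<epsilon>"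
      using small[OF \<epsilon>] by blast
    have "p (v m - v n) < \<epsilon>" if "m \<ge> N" "n \<ge> N" for m n
    proof (cases "n \<le> m")
      case True
      then show ?thesis
        using le_less_trans[OF close[OF True]] N \<open>n \<ge> N\<close> by simp
    next
      case False
      then have "m \<le> n" by simp
      from le_less_trans[OF close[OF this]] show ?thesis
        using N \<open>m \<ge> N\<close> seminorm_commute[OF p, of "v m" "v n"] by simp
    qed
    then show ?thesis by blast
  qed
  then obtain l where l: "(\<lambda>n. p (v n - l)) \<longlonglongrightarrow> 0"
    using complete unfolding complete_seminorm_def by blast
  have "l \<in> seminorm_closure p (W + \<L> W)"
    unfolding seminorm_closure_def
  proof (intro CollectI allI impI)
    fix \<epsilon> :: real assume "\<epsilon> > 0"
    then obtain n where "p (v n - l) < \<epsilon>"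
      using order_tendstoD(2)[OF l] by (auto simp: eventually_sequentially)
    moreover have "v n \<in> W + \<L> W"
      using set_plus_intro[OF w(1) coset, of n n] by simp
    ultimately show "\<exists>s \<in> W + \<L> W. p (l - s) < \<epsilon>"
      using seminorm_commute[OF p] by metis
  qed
  moreover have "(err l \<longlongrightarrow> 0) (folner G)"
  proof -
    have "\<forall>\<^sub>F F in folner G. err l F < \<epsilon>" if \<epsilon>: "\<epsilon> > 0" for \<epsilon>
    proof -
      define \<eta> where "\<eta> = \<epsilon> / (C + 2)"
      have "\<eta> > 0" "(C + 2) * \<eta> = \<epsilon>"
        using \<epsilon> C_nonneg by (simp_all add: \<eta>_def)
      then have \<eta>: "\<eta> > 0" "C * \<eta> + 2 * \<eta> = \<epsilon>"
        by (simp_all add: distrib_right)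
      have "\<forall>\<^sub>F n in sequentially. p (v n - l) < \<eta> \<and> 1 * (1/2) ^ n < \<eta>"
        using order_tendstoD(2)[OF l \<eta>(1)] small[OF \<eta>(1), of 1]
        by (simp add: eventually_conj_iff eventually_sequentially)
      then obtain n where n: "p (v n - l) < \<eta>" "(1/2) ^ n < \<eta>"
        by (auto simp: eventually_sequentially)
      have "\<forall>\<^sub>F F in folner G. p (A F (v n - w n)) < \<eta>"
        using order_tendstoD(2)[OF tendsto_average_coboundaries[OF coset] \<eta>(1)] .
      with w(2)[of n] eventually_folner_finsets show ?thesis
      proof eventually_elim
        case (elim F)
        have "A F (w n - l) = A F (v n - l) - A F (v n - w n)"
          using elim(2) by (simp add: linear_diff[OF linear_average])
        then have "p (A F (w n - l)) \<le> C * p (v n - l) + p (A F (v n - w n))"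
          using seminorm_diff_le[OF p, of "A F (v n - l)" "A F (v n - w n)"]
            average_bound[OF elim(2), of "v n - l"] by simp
        moreover have "C * p (v n - l) \<le> C * \<eta>"
          using n(1) C_nonneg by (simp add: mult_left_mono)
        ultimately show ?case
          using err_perturb[OF elim(2), of l "w n"] elim n(2) \<eta>(2) by linarith
      qed
    qed
    then show ?thesis
      by (simp add: tendsto_iff seminorm_nonneg[OF p])
  qed
  ultimately show ?thesis
    unfolding mem_realizations_iff by blast
qed

lemma realization_mem_closure:
  assumes v: "v \<in> \<R>" "v \<in> seminorm_closure p (W + \<L> W)" and u: "u \<in> \<R>"
  shows "u \<in> seminorm_closure p (W + \<L> UNIV)"
  unfolding seminorm_closure_def
proof (intro CollectI allI impI)
  fix \<epsilon> :: real assume "\<epsilon> > 0"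
  then have half: "\<epsilon> / 2 > 0" by simp
  obtain s where "s \<in> W + \<L> W" "p (v - s) < \<epsilon> / 2"
    using v(2) half unfolding seminorm_closure_def by blast
  then obtain w l where wl: "w \<in> W" "l \<in> \<L> W" "p (v - (w + l)) < \<epsilon> / 2"
    by (auto elim!: set_plus_elim)
  obtain k where k: "k \<in> \<L> UNIV" "p (u - v - k) < \<epsilon> / 2"
    using realization_diff[OF u v(1)] half unfolding seminorm_closure_def by blast
  have "l + k \<in> \<L> UNIV"
    using wl(2) k(1) coboundaries_mono[of W UNIV] unfolding coboundaries_def
    by (auto intro: span_add)
  then have "w + (l + k) \<in> W + \<L> UNIV"
    using wl(1) by (rule set_plus_intro[rotated])
  moreover have "u - (w + (l + k)) = (v - (w + l)) + (u - v - k)"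
    by simp
  then have "p (u - (w + (l + k))) \<le> p (v - (w + l)) + p (u - v - k)"
    by (metis seminorm_triangle[OF p])
  then have "p (u - (w + (l + k))) < \<epsilon>"
    using wl(3) k(2) by linarith
  ultimately show "\<exists>s \<in> W + \<L> UNIV. p (u - s) < \<epsilon>"
    by blast
qed

text \<open>
  If \<open>\<R>\<close> contains some \<open>w \<in> W\<close>, it is the coset \<open>w + closure \<L>\<close>, which leaves nothing outside
  \<open>W + closure \<L>\<close>. If it does not, no realization is of the form \<open>w + l\<close> with \<open>w \<in> W\<close> and \<open>l\<close> in
  the closure, since \<open>w\<close> would then be a realization as well.
\<close>

lemma realization_dichotomy:
  assumes "\<R> \<noteq> {}"
  shows "(\<exists>w \<in> W. w \<in> \<R>) \<noteq> (\<exists>v \<in> UNIV - (W + seminorm_closure p (\<L> UNIV)). v \<in> \<R>)"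
proof (cases "\<exists>w \<in> W. w \<in> \<R>")
  case True
  then obtain w where w: "w \<in> W" "w \<in> \<R>" by blast
  have "v \<in> W + seminorm_closure p (\<L> UNIV)" if "v \<in> \<R>" for v
    using set_plus_intro[OF w(1) realization_diff[OF that w(2)]] by simp
  then show ?thesis
    using True by blast
next
  case False
  obtain v where v: "v \<in> \<R>" using assms by blast
  have "v \<notin> W + seminorm_closure p (\<L> UNIV)"
  proof
    assume "v \<in> W + seminorm_closure p (\<L> UNIV)"
    then obtain w l where "w \<in> W" "l \<in> seminorm_closure p (\<L> UNIV)" "v = w + l"
      by (rule set_plus_elim)
    then show False
      using realization_shift[OF v, of w] False by auto
  qed
  then show ?thesis
    using False v by blast
qed

end

end

section \<open>The equivalence and the dichotomy\<close>

theorem theorem2: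
  fixes G :: "('g, 'b) monoid_scheme"
    and p :: "'v::real_vector \<Rightarrow> real"
    and \<pi> :: "'g \<Rightarrow> 'v \<Rightarrow> 'v"
    and \<phi> :: "'g set \<Rightarrow> 'v"
    and W :: "'v set"
  assumes "group G" and "countable (carrier G)" and "amenable G"
    and "seminorm p" and "complete_seminorm p"
    and "representation G p \<pi>" and "uniformly_bounded G p \<pi>"
    and "\<phi> \<in> set_maps G p \<pi>"
    and "W \<noteq> {}"
  shows "(asymptotically_additive G p \<pi> \<phi> W \<longleftrightarrow>
            (\<exists>v \<in> seminorm_closure p (W + coboundaries G \<pi> W).
               v \<in> additive_realizations G p \<pi> \<phi>)) \<and>
         (asymptotically_additive G p \<pi> \<phi> W \<longrightarrow>
            additive_realizations G p \<pi> \<phi>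
              \<subseteq> seminorm_closure p (W + coboundaries G \<pi> UNIV) \<and>
            ((\<exists>w \<in> W. w \<in> additive_realizations G p \<pi> \<phi>) \<noteq>
             (\<exists>v \<in> UNIV - (W + seminorm_closure p (coboundaries G \<pi> UNIV)).
                v \<in> additive_realizations G p \<pi> \<phi>)))"
proof -
  obtain C where C: "0 \<le> C" "\<And>g v. g \<in> carrier G \<Longrightarrow> p (\<pi> g v) \<le> C * p v"
    by (rule uniform_operator_bound[OF assms(4,6,7)]) (rule that)
  interpret bounded_amenable_representation G p \<pi> C
  proof (intro bounded_amenable_representation.intro bounded_amenable_representation_axioms.intro)
    fix g h v assume "g \<in> carrier G" "h \<in> carrier G"
    then have "\<pi> (g \<otimes>\<^bsub>G\<^esub> h) = \<pi> g \<circ> \<pi> h"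
      using assms(6) unfolding representation_def by (auto simp: hom_def isom_group_def)
    then show "\<pi> (g \<otimes>\<^bsub>G\<^esub> h) v = \<pi> g (\<pi> h v)" by simp
  next
    fix g assume "g \<in> carrier G"
    then show "linear (\<pi> g)"
      using assms(6) unfolding representation_def hom_def isom_group_def bounded_operator_def
      by auto
  qed (use assms C in auto)
  have equiv: "asymptotically_additive G p \<pi> \<phi> W \<longleftrightarrow>
      (\<exists>v \<in> seminorm_closure p (W + coboundaries G \<pi> W). v \<in> additive_realizations G p \<pi> \<phi>)"
    unfolding asymptotically_additive_iff[OF assms(9)]
    using realization_exists[OF assms(5)] approximation_from_realization by blast
  moreover have "additive_realizations G p \<pi> \<phi> \<subseteq> seminorm_closure p (W + coboundaries G \<pi> UNIV)"
    if "asymptotically_additive G p \<pi> \<phi> W"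
    using that equiv realization_mem_closure by blast
  moreover have "additive_realizations G p \<pi> \<phi> \<noteq> {}"
    if "asymptotically_additive G p \<pi> \<phi> W"
    using that equiv by blast
  ultimately show ?thesis
    using realization_dichotomy by blast
qed

end
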